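(* Let $T_4$ be the $4$-regular tree and let $T_4 \Box \mathbb{Z}$ be the Cartesian product graph of $T_4$ and the line $\mathbb{Z}$. Then the critical probability for Bernoulli bond percolation on $T_4\Box\mathbb{Z}$ satisfies $$p_c(T_4 \Box \mathbb{Z}) < 0.225.$$
   Context: $T_4$ is the infinite tree in which every vertex has degree $4$; $\mathbb{Z}$ denotes the graph on the integers with edges $\{k,k+1\}$. The Cartesian product $G_1\Box G_2$ has vertex set $V(G_1)\times V(G_2)$, with $(u,k)$ and $(v,l)$ adjacent iff ($u=v$ and $\{k,l\}\in E(G_2)$) or ($\{u,v\}\in E(G_1)$ and $k=l$). Bernoulli bond percolation with parameter $p\in[0,1]$ on an infinite, connected, locally finite graph $G=(V,E)$: each edge is independently open with probability $p$ and closed with probability $1-p$. Clusters are the connected components of the subgraph of open edges. The critical probability is $$p_c(G)=\inf\{p\in[0,1] \mid \text{there exists an infinite cluster almost surely}\}.$$ *)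

theory Defs
  imports "HOL-Probability.Probability"
begin

datatype 'a graph = Graph (verts: "'a set") (edges: "'a set set")

definition simple_graph :: "'a graph \<Rightarrow> bool" where
  "simple_graph G \<longleftrightarrow> (\<forall>e\<in>edges G. e \<subseteq> verts G \<and> card e = 2)"

definition adj :: "'a set set \<Rightarrow> 'a \<Rightarrow> 'a \<Rightarrow> bool" where
  "adj E u v \<longleftrightarrow> {u, v} \<in> E"

text \<open>The connected component of \<open>x\<close> in the graph with edge set \<open>E\<close>
  (on any vertex set that contains \<open>x\<close> and all edges of \<open>E\<close>).\<close>

definition component :: "'a set set \<Rightarrow> 'a \<Rightarrow> 'a set" where
  "component E x = {y. (adj E)\<^sup>*\<^sup>* x y}"

definition connected_graph :: "'a graph \<Rightarrow> bool" where
  "connected_graph G \<longleftrightarrow>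
    verts G \<noteq> {} \<and> (\<forall>x\<in>verts G. \<forall>y\<in>verts G. y \<in> component (edges G) x)"

definition graph_cycle :: "'a graph \<Rightarrow> 'a list \<Rightarrow> bool" where
  "graph_cycle G c \<longleftrightarrow>
    length c \<ge> 3 \<and> distinct c \<and> set c \<subseteq> verts G \<and>
    successively (adj (edges G)) c \<and> adj (edges G) (last c) (hd c)"

definition tree_graph :: "'a graph \<Rightarrow> bool" where
  "tree_graph G \<longleftrightarrow> simple_graph G \<and> connected_graph G \<and> (\<nexists>c. graph_cycle G c)"

text \<open>As \<open>card\<close> is \<open>0\<close> on infinite sets, a positive degree entails that only finitely many
  edges are incident to the vertex.\<close>

definition vertex_degree :: "'a graph \<Rightarrow> 'a \<Rightarrow> nat" where
  "vertex_degree G v = card {e \<in> edges G. v \<in> e}"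

definition infinite_regular_tree :: "nat \<Rightarrow> 'a graph \<Rightarrow> bool" where
  "infinite_regular_tree d G \<longleftrightarrow>
    tree_graph G \<and> infinite (verts G) \<and> (\<forall>v\<in>verts G. vertex_degree G v = d)"

definition int_line :: "int graph" where
  "int_line = Graph UNIV {{k, k + 1} | k. True}"

definition cartesian_product :: "'a graph \<Rightarrow> 'b graph \<Rightarrow> ('a \<times> 'b) graph" where
  "cartesian_product G H = Graph (verts G \<times> verts H)
    {{(u, k), (v, l)} | u k v l.
      u \<in> verts G \<and> v \<in> verts G \<and> k \<in> verts H \<and> l \<in> verts H \<and>
      (u = v \<and> {k, l} \<in> edges H \<or> {u, v} \<in> edges G \<and> k = l)}"

text \<open>A percolation configuration maps each edge to \<open>True\<close> (open) or \<open>False\<close> (closed).\<close>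

definition bond_percolation :: "'a graph \<Rightarrow> real \<Rightarrow> ('a set \<Rightarrow> bool) measure" where
  "bond_percolation G p = Pi\<^sub>M (edges G) (\<lambda>_. measure_pmf (bernoulli_pmf p))"

definition open_edges :: "'a graph \<Rightarrow> ('a set \<Rightarrow> bool) \<Rightarrow> 'a set set" where
  "open_edges G \<omega> = {e \<in> edges G. \<omega> e}"

definition cluster :: "'a graph \<Rightarrow> ('a set \<Rightarrow> bool) \<Rightarrow> 'a \<Rightarrow> 'a set" where
  "cluster G \<omega> x = component (open_edges G \<omega>) x"

definition critical_prob :: "'a graph \<Rightarrow> real" where
  "critical_prob G =
    Inf {p \<in> {0..1}. AE \<omega> in bond_percolation G p. \<exists>x\<in>verts G. infinite (cluster G \<omega> x)}"

end

theory Submission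
  imports Defs "HOL-Library.Sublist"
begin

text \<open>Only paths that never return towards the root of a ternary subtree are used. If the cluster
  hits \<open>k\<close> sites of a fibre \<open>{v} \<times> \<int>\<close>, then inside the fibre it spreads to at least
  \<open>k + L + R\<close> sites, where \<open>L\<close> and \<open>R\<close> are the independent geometric runs of open edges to the left
  of the leftmost and to the right of the rightmost hit site; each of these sites then hits the
  corresponding site of each of the three child fibres with probability \<open>p\<close>. Truncating the number of
  hits at 2 leaves a two-type branching process, which at \<open>p = 0.224\<close> is supercritical even when the
  runs are truncated at length 3. Hence the probability of reaching every depth is bounded away from
  0, and the independent subtrees hanging off a ray give an infinite cluster almost surely.\<close>

section \<open>Independent Bernoulli coordinates\<close>

text \<open>Plays the part of measurability with respect to the coordinates in \<open>J\<close>,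
  which may be infinitely many; disjoint index sets will give independent events.\<close>

definition depends_on :: "'e set \<Rightarrow> (('e \<Rightarrow> bool) \<Rightarrow> bool) \<Rightarrow> bool" where
  "depends_on J Q \<longleftrightarrow> (\<forall>\<omega> \<omega>'. (\<forall>e\<in>J. \<omega> e = \<omega>' e) \<longrightarrow> Q \<omega> = Q \<omega>')"

lemma depends_onI:
  assumes "\<And>\<omega> \<omega>'. (\<And>e. e \<in> J \<Longrightarrow> \<omega> e = \<omega>' e) \<Longrightarrow> Q \<omega> = Q \<omega>'"
  shows "depends_on J Q"
  unfolding depends_on_def
proof (intro allI impI)
  fix \<omega> \<omega>' :: "'a \<Rightarrow> bool"
  assume "\<forall>e\<in>J. \<omega> e = \<omega>' e"
  then show "Q \<omega> = Q \<omega>'"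
    by (intro assms) (rule bspec)
qed

lemma depends_onD:
  assumes "depends_on J Q" "\<And>e. e \<in> J \<Longrightarrow> \<omega> e = \<omega>' e"
  shows "Q \<omega> = Q \<omega>'"
proof -
  have "\<forall>e\<in>J. \<omega> e = \<omega>' e"
    by (rule ballI) (rule assms(2))
  then show ?thesis
    using assms(1)[unfolded depends_on_def, rule_format, of \<omega> \<omega>'] by blast
qed

lemma depends_on_mono: "depends_on J Q \<Longrightarrow> J \<subseteq> K \<Longrightarrow> depends_on K Q"
  unfolding depends_on_def by blast

lemma depends_on_Not:
  assumes "depends_on J Q"
  shows "depends_on J (\<lambda>\<omega>. \<not> Q \<omega>)"
proof (rule depends_onI)
  fix \<omega> \<omega>' :: "'a \<Rightarrow> bool"
  assume eq: "\<And>e. e \<in> J \<Longrightarrow> \<omega> e = \<omega>' e"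
  show "(\<not> Q \<omega>) = (\<not> Q \<omega>')"
    using depends_onD[OF assms eq] by simp
qed

lemma depends_on_conj:
  assumes "depends_on J Q" "depends_on J R"
  shows "depends_on J (\<lambda>\<omega>. Q \<omega> \<and> R \<omega>)"
proof (rule depends_onI)
  fix \<omega> \<omega>' :: "'a \<Rightarrow> bool"
  assume eq: "\<And>e. e \<in> J \<Longrightarrow> \<omega> e = \<omega>' e"
  show "(Q \<omega> \<and> R \<omega>) = (Q \<omega>' \<and> R \<omega>')"
    using depends_onD[OF assms(1) eq] depends_onD[OF assms(2) eq] by simp
qed

lemma depends_on_disj:
  assumes "depends_on J Q" "depends_on J R"
  shows "depends_on J (\<lambda>\<omega>. Q \<omega> \<or> R \<omega>)"
proof (rule depends_onI)
  fix \<omega> \<omega>' :: "'a \<Rightarrow> bool"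
  assume eq: "\<And>e. e \<in> J \<Longrightarrow> \<omega> e = \<omega>' e"
  show "(Q \<omega> \<or> R \<omega>) = (Q \<omega>' \<or> R \<omega>')"
    using depends_onD[OF assms(1) eq] depends_onD[OF assms(2) eq] by simp
qed

text \<open>The mean of \<open>q\<close> at the minimum of \<open>m\<close> and a geometric random variable.\<close>

fun geom_mean :: "real \<Rightarrow> nat \<Rightarrow> (nat \<Rightarrow> real) \<Rightarrow> real" where
  "geom_mean p 0 q = q 0"
| "geom_mean p (Suc m) q = p * geom_mean p m (\<lambda>t. q (Suc t)) + (1 - p) * q 0"

lemma geom_mean_mono:
  "0 \<le> p \<Longrightarrow> p \<le> 1 \<Longrightarrow> (\<And>t. t \<le> m \<Longrightarrow> q t \<le> q' t) \<Longrightarrow> geom_mean p m q \<le> geom_mean p m q'"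
  by (induction m arbitrary: q q') (auto intro!: add_mono mult_left_mono)

text \<open>The mean of \<open>f (k + N)\<close>, where \<open>N\<close> is binomial with parameters \<open>m\<close> and \<open>p\<close>.\<close>

fun binomial_mean :: "real \<Rightarrow> (nat \<Rightarrow> real) \<Rightarrow> nat \<Rightarrow> nat \<Rightarrow> real" where
  "binomial_mean p f k 0 = f k"
| "binomial_mean p f k (Suc m) = p * binomial_mean p f (Suc k) m + (1 - p) * binomial_mean p f k m"

section \<open>Independence and one-edge conditioning in a Bernoulli product space\<close>

locale bernoulli_product =
  fixes p :: real and \<mu> :: "('e \<Rightarrow> bool) measure"
  assumes p01: "0 \<le> p" "p \<le> 1"
  assumes \<mu>: "\<mu> = Pi\<^sub>M UNIV (\<lambda>_. measure_pmf (bernoulli_pmf p))"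
begin

sublocale prob_space \<mu>
  unfolding \<mu> by (intro prob_space_PiM prob_space_measure_pmf)

lemma space_\<mu>[simp]: "space \<mu> = UNIV"
  by (simp add: \<mu> space_PiM)

lemma measurable_coordinate[measurable]: "Measurable.pred \<mu> (\<lambda>\<omega>. \<omega> e)"
proof -
  have "(\<lambda>\<omega>. \<omega> e) \<in> measurable \<mu> (measure_pmf (bernoulli_pmf p))"
    unfolding \<mu> by (rule measurable_component_singleton) simp
  then show ?thesis
    by (simp cong: measurable_cong_sets)
qed

lemma event_pred[simp]: "Measurable.pred \<mu> Q \<Longrightarrow> {\<omega>. Q \<omega>} \<in> sets \<mu>"
  by (simp add: pred_def)

lemma prob_coordinate: "prob {\<omega>. \<omega> e} = p"
proof -
  have "measure (distr \<mu> (measure_pmf (bernoulli_pmf p)) (\<lambda>\<omega>. \<omega> e)) {True} = p"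
    unfolding \<mu> using p01
    by (subst distr_PiM_component) (auto simp: prob_space_measure_pmf measure_pmf_single)
  then show ?thesis
    by (subst (asm) measure_distr) (auto simp: vimage_def)
qed

lemma prob_not: "Measurable.pred \<mu> Q \<Longrightarrow> prob {\<omega>. \<not> Q \<omega>} = 1 - prob {\<omega>. Q \<omega>}"
  using prob_neg[of Q] by simp

lemma prob_mono: "Measurable.pred \<mu> R \<Longrightarrow> (\<And>\<omega>. Q \<omega> \<Longrightarrow> R \<omega>) \<Longrightarrow> prob {\<omega>. Q \<omega>} \<le> prob {\<omega>. R \<omega>}"
  by (rule finite_measure_mono) auto

lemma indep_coordinates: "indep_vars (\<lambda>_. measure_pmf (bernoulli_pmf p)) (\<lambda>e \<omega>. \<omega> e) UNIV"
proof (subst indep_vars_iff_distr_eq_PiM')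
  show "distr \<mu> (\<Pi>\<^sub>M e\<in>UNIV. measure_pmf (bernoulli_pmf p)) (\<lambda>\<omega>. \<lambda>e\<in>UNIV. \<omega> e) =
      (\<Pi>\<^sub>M e\<in>UNIV. distr \<mu> (measure_pmf (bernoulli_pmf p)) (\<lambda>\<omega>. \<omega> e))"
    unfolding \<mu> restrict_UNIV
    by (subst distr_PiM_component) (simp_all add: distr_id2 prob_space_measure_pmf)
qed simp_all

text \<open>Each predicate factors through the restriction of the configuration to its own index
  set, and restrictions of independent coordinates to disjoint sets are independent.\<close>

lemma prob_conj:
  assumes Q: "Measurable.pred \<mu> Q" "depends_on J Q"
    and R: "Measurable.pred \<mu> R" "depends_on K R"
    and JK: "J \<inter> K = {}"
  shows "prob {\<omega>. Q \<omega> \<and> R \<omega>} = prob {\<omega>. Q \<omega>} * prob {\<omega>. R \<omega>}"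
proof -
  let ?B = "\<lambda>_. measure_pmf (bernoulli_pmf p)"
  \<comment> \<open>The default \<open>False\<close> outside \<open>J\<close> is arbitrary: it
    completes a restricted configuration so that \<open>Q\<close> can be evaluated on it.\<close>
  let ?ext = "\<lambda>J (x :: 'e \<Rightarrow> bool) e. if e \<in> J then x e else False"
  have ext: "?ext J \<in> measurable (Pi\<^sub>M J ?B) \<mu>" for J :: "'e set"
    unfolding \<mu>
  proof (rule measurable_PiM_single')
    fix e :: 'e
    show "(\<lambda>x. ?ext J x e) \<in> measurable (Pi\<^sub>M J ?B) (measure_pmf (bernoulli_pmf p))"
      using measurable_component_singleton[of e J ?B] by (cases "e \<in> J") simp_all
  qed (auto simp: space_PiM)
  have restr: "Q (?ext J (restrict \<omega> J)) = Q \<omega>" if "depends_on J Q" for J Q \<omega>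
    by (rule depends_onD[OF that]) simp
  have meas_ext: "{x \<in> space (Pi\<^sub>M J ?B). Q (?ext J x)} \<in> sets (Pi\<^sub>M J ?B)"
    if "Measurable.pred \<mu> Q" for J Q
    using measurable_compose[OF ext[of J] that] unfolding pred_def .
  have "indep_var (Pi\<^sub>M J ?B) (\<lambda>\<omega>. restrict \<omega> J) (Pi\<^sub>M K ?B) (\<lambda>\<omega>. restrict \<omega> K)"
    using indep_var_restrict[OF indep_coordinates JK] by simp
  from indep_varD[OF this meas_ext[OF Q(1), of J] meas_ext[OF R(1), of K]]
  have "prob {\<omega>. Q (?ext J (restrict \<omega> J)) \<and> R (?ext K (restrict \<omega> K))} =
      prob {\<omega>. Q (?ext J (restrict \<omega> J))} * prob {\<omega>. R (?ext K (restrict \<omega> K))}"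
    by (simp add: vimage_def space_PiM)
  then show ?thesis
    by (simp only: restr[OF Q(2)] restr[OF R(2)])
qed

lemma prob_split_coordinate:
  assumes Q: "Measurable.pred \<mu> Q" "depends_on J Q" and R: "Measurable.pred \<mu> R" "depends_on J R"
    and e: "e \<notin> J"
  shows "prob {\<omega>. \<omega> e \<and> Q \<omega> \<or> \<not> \<omega> e \<and> R \<omega>} = p * prob {\<omega>. Q \<omega>} + (1 - p) * prob {\<omega>. R \<omega>}"
proof -
  note [measurable] = Q(1) R(1)
  have "prob {\<omega>. \<omega> e \<and> Q \<omega> \<or> \<not> \<omega> e \<and> R \<omega>} =
      prob ({\<omega>. \<omega> e \<and> Q \<omega>} \<union> {\<omega>. \<not> \<omega> e \<and> R \<omega>})"
    by (rule arg_cong[of _ _ prob]) auto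
  also have "\<dots> = prob {\<omega>. \<omega> e \<and> Q \<omega>} + prob {\<omega>. \<not> \<omega> e \<and> R \<omega>}"
    by (rule finite_measure_Union) auto
  also have "prob {\<omega>. \<omega> e \<and> Q \<omega>} = p * prob {\<omega>. Q \<omega>}"
    using e Q by (subst prob_conj[where J = "{e}" and K = J]) (auto simp: prob_coordinate intro: depends_onI)
  also have "prob {\<omega>. \<not> \<omega> e \<and> R \<omega>} = (1 - p) * prob {\<omega>. R \<omega>}"
    using e R by (subst prob_conj[where J = "{e}" and K = J])
      (auto simp: prob_coordinate prob_not intro: depends_onI)
  finally show ?thesis .
qed

lemma pred_run:
  fixes m :: nat
  assumes [measurable]: "\<And>t. t \<le> m \<Longrightarrow> Measurable.pred \<mu> (Q t)"
  shows "Measurable.pred \<mu> (\<lambda>\<omega>. \<exists>t\<le>m. (\<forall>s<t. \<omega> (e s)) \<and> Q t \<omega>)"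
proof -
  have "Measurable.pred \<mu> (\<lambda>\<omega>. \<exists>t\<in>{..m}. (\<forall>s\<in>{..<t}. \<omega> (e s)) \<and> Q t \<omega>)"
    by measurable
  then show ?thesis by (simp add: Bex_def Ball_def)
qed

text \<open>Condition on \<open>e 0\<close>: if it is closed, \<open>t = 0\<close> is a witness; if
  it is open, a witness for the shifted run gains one edge. Only an inequality results, since
  \<open>Q t\<close> also counts when the run continues beyond \<open>t\<close>.\<close>

lemma prob_run:
  assumes "\<And>t. t \<le> m \<Longrightarrow> Measurable.pred \<mu> (Q t)" "\<And>t. t \<le> m \<Longrightarrow> depends_on J (Q t)"
    and "inj_on e {..<m}" "e ` {..<m} \<inter> J = {}"
  shows "geom_mean p m (\<lambda>t. prob {\<omega>. Q t \<omega>}) \<le> prob {\<omega>. \<exists>t\<le>m. (\<forall>s<t. \<omega> (e s)) \<and> Q t \<omega>}"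
  using assms
proof (induction m arbitrary: Q e)
  case 0
  then show ?case by simp
next
  case (Suc m)
  let ?R = "\<lambda>\<omega>. \<exists>t\<le>m. (\<forall>s<t. \<omega> (e (Suc s))) \<and> Q (Suc t) \<omega>"
  have meas[measurable]: "t \<le> m \<Longrightarrow> Measurable.pred \<mu> (Q (Suc t))" "Measurable.pred \<mu> (Q 0)" for t
    using Suc.prems(1) by auto
  have R[measurable]: "Measurable.pred \<mu> ?R"
    using Suc.prems(1) by (intro pred_run) auto
  have disj: "e 0 \<notin> e ` {1..m}" "e 0 \<notin> J" "inj_on (\<lambda>s. e (Suc s)) {..<m}"
    using Suc.prems(3,4) by (fastforce simp: inj_on_def)+
  have "geom_mean p (Suc m) (\<lambda>t. prob {\<omega>. Q t \<omega>}) =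
      p * geom_mean p m (\<lambda>t. prob {\<omega>. Q (Suc t) \<omega>}) + (1 - p) * prob {\<omega>. Q 0 \<omega>}"
    by simp
  also have "\<dots> \<le> p * prob {\<omega>. ?R \<omega>} + (1 - p) * prob {\<omega>. Q 0 \<omega>}"
    using Suc.prems disj p01
    by (intro add_mono mult_left_mono Suc.IH order_refl) (auto simp: image_subset_iff disjoint_iff)
  also have "\<dots> = prob {\<omega>. \<omega> (e 0) \<and> ?R \<omega> \<or> \<not> \<omega> (e 0) \<and> Q 0 \<omega>}"
  proof (rule prob_split_coordinate[symmetric])
    show "depends_on (J \<union> e ` {1..m}) ?R"
    proof (rule depends_onI)
      fix \<omega> \<omega>' :: "'e \<Rightarrow> bool"
      assume eq: "\<omega> x = \<omega>' x" if "x \<in> J \<union> e ` {1..m}" for x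
      have "Q (Suc t) \<omega> = Q (Suc t) \<omega>'" if "t \<le> m" for t
        using that eq by (intro depends_onD[OF Suc.prems(2)]) auto
      moreover have "\<omega> (e (Suc s)) = \<omega>' (e (Suc s))" if "s < m" for s
        using that by (intro eq) auto
      ultimately show "?R \<omega> = ?R \<omega>'"
        by (meson less_le_trans)
    qed
    show "depends_on (J \<union> e ` {1..m}) (Q 0)"
      by (auto intro: depends_on_mono[OF Suc.prems(2)])
  qed (use disj in auto)
  also have "\<dots> \<le> prob {\<omega>. \<exists>t\<le>Suc m. (\<forall>s<t. \<omega> (e s)) \<and> Q t \<omega>}"
  proof (rule prob_mono)
    show "Measurable.pred \<mu> (\<lambda>\<omega>. \<exists>t\<le>Suc m. (\<forall>s<t. \<omega> (e s)) \<and> Q t \<omega>)"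
      using Suc.prems(1) by (intro pred_run) auto
  next
    fix \<omega> assume *: "\<omega> (e 0) \<and> ?R \<omega> \<or> \<not> \<omega> (e 0) \<and> Q 0 \<omega>"
    show "\<exists>t\<le>Suc m. (\<forall>s<t. \<omega> (e s)) \<and> Q t \<omega>"
    proof (cases "\<omega> (e 0)")
      case True
      with * obtain t where "t \<le> m" "\<forall>s<t. \<omega> (e (Suc s))" "Q (Suc t) \<omega>" by auto
      with True have "Suc t \<le> Suc m \<and> (\<forall>s<Suc t. \<omega> (e s)) \<and> Q (Suc t) \<omega>"
        by (auto simp: less_Suc_eq_0_disj)
      then show ?thesis by blast
    qed (use * in auto)
  qed
  finally show ?case .
qed

text \<open>\<open>T\<close> holds the sites whose edge is already known to be open,
  \<open>S\<close> those still to be examined. Examining one more edge moves its site to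
  \<open>T\<close> with probability \<open>p\<close> and drops it otherwise, which is the recursion
  of \<open>binomial_mean\<close>. The induction needs a general \<open>T\<close>.\<close>

lemma prob_thinned:
  fixes Q :: "'i :: countable \<Rightarrow> ('e \<Rightarrow> bool) \<Rightarrow> bool"
  assumes "finite S" "finite T" "S \<inter> T = {}"
    and Q[measurable]: "\<And>i. Measurable.pred \<mu> (Q i)" and Qd: "\<And>i. depends_on J (Q i)"
    and v: "inj_on v S" "v ` S \<inter> J = {}"
    and f: "\<And>T. finite T \<Longrightarrow> f (card T) \<le> prob {\<omega>. \<exists>i\<in>T. Q i \<omega>}"
  shows "binomial_mean p f (card T) (card S) \<le>
    prob {\<omega>. (\<exists>i\<in>T. Q i \<omega>) \<or> (\<exists>i\<in>S. \<omega> (v i) \<and> Q i \<omega>)}"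
  using assms(1,2,3) v
proof (induction S arbitrary: T)
  case empty
  then show ?case using f by simp
next
  case (insert s S)
  let ?E = "\<lambda>T \<omega>. (\<exists>i\<in>T. Q i \<omega>) \<or> (\<exists>i\<in>S. \<omega> (v i) \<and> Q i \<omega>)"
  have "binomial_mean p f (card T) (card (insert s S)) =
      p * binomial_mean p f (card (insert s T)) (card S) + (1 - p) * binomial_mean p f (card T) (card S)"
    using insert.hyps insert.prems by simp
  also have "\<dots> \<le> p * prob {\<omega>. ?E (insert s T) \<omega>} + (1 - p) * prob {\<omega>. ?E T \<omega>}"
    using insert.prems insert.hyps p01
    by (intro add_mono mult_left_mono insert.IH) (auto simp: inj_on_def)
  also have "\<dots> = prob {\<omega>. \<omega> (v s) \<and> ?E (insert s T) \<omega> \<or> \<not> \<omega> (v s) \<and> ?E T \<omega>}"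
  proof (rule prob_split_coordinate[symmetric])
    have dep: "depends_on (J \<union> v ` S) (?E T)" for T
    proof (rule depends_onI)
      fix \<omega> \<omega>' :: "'e \<Rightarrow> bool"
      assume eq: "\<omega> x = \<omega>' x" if "x \<in> J \<union> v ` S" for x
      have "Q i \<omega> = Q i \<omega>'" for i
        by (rule depends_onD[OF Qd]) (simp add: eq)
      then show "?E T \<omega> = ?E T \<omega>'"
        using eq by auto
    qed
    show "depends_on (J \<union> v ` S) (?E (insert s T))" "depends_on (J \<union> v ` S) (?E T)"
      by (rule dep)+
    show "v s \<notin> J \<union> v ` S"
      using insert.prems insert.hyps by (auto simp: inj_on_def)
  qed measurable
  also have "\<dots> = prob {\<omega>. (\<exists>i\<in>T. Q i \<omega>) \<or> (\<exists>i\<in>insert s S. \<omega> (v i) \<and> Q i \<omega>)}"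
    by (rule arg_cong[of _ _ prob]) auto
  finally show ?case .
qed

end

section \<open>Ternary subtrees of the 4-regular tree\<close>

datatype branch = Branch0 | Branch1 | Branch2

instance branch :: countable
  by countable_datatype

lemma ex_branch: "(\<exists>j. P j) \<longleftrightarrow> P Branch0 \<or> P Branch1 \<or> P Branch2"
  by (metis branch.exhaust)



text \<open>A shortest nonbacktracking walk returning to its start would be a cycle: by induction
  all shorter pieces have distinct endpoints, so no vertex repeats before the end.\<close>

lemma nonbacktracking_walk_endpoints:
  fixes x :: "nat \<Rightarrow> 'a"
  assumes G: "simple_graph G" "\<nexists>c. graph_cycle G c"
  shows "0 < n \<Longrightarrow> (\<And>i. i < n \<Longrightarrow> adj (edges G) (x i) (x (Suc i))) \<Longrightarrow>
    (\<And>i. Suc (Suc i) \<le> n \<Longrightarrow> x i \<noteq> x (Suc (Suc i))) \<Longrightarrow> x 0 \<noteq> x n"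
proof (induction n arbitrary: x rule: less_induct)
  case (less n)
  have inj: "x i \<noteq> x j" if "i < j" "j < n" for i j
    using less.IH[of "j - i" "\<lambda>t. x (i + t)"] less.prems that by auto
  show ?case
  proof
    assume eq: "x 0 = x n"
    \<comment> \<open>Length 1 would be a loop and length 2 a backtrack, so the closed walk has at
      least the three vertices that \<open>graph_cycle\<close> demands.\<close>
    have "n \<noteq> 1"
      using less.prems(2)[of 0] eq G(1) by (fastforce simp: adj_def simple_graph_def)
    moreover have "n \<noteq> 2"
      using less.prems(3)[of 0] eq by (auto simp: numeral_2_eq_2)
    ultimately have n: "n \<ge> 3"
      using less.prems(1) by simp
    have "graph_cycle G (map x [0..<n])"
      unfolding graph_cycle_def
    proof (intro conjI)
      show "distinct (map x [0..<n])"
        using inj by (auto simp: distinct_map inj_on_def) (metis nat_neq_iff)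
      show "set (map x [0..<n]) \<subseteq> verts G"
        using less.prems(2) G(1) by (fastforce simp: adj_def simple_graph_def)
      show "successively (adj (edges G)) (map x [0..<n])"
        using less.prems(2) by (auto simp: successively_conv_nth)
      have "last (map x [0..<n]) = x (n - 1)" "hd (map x [0..<n]) = x n"
        using n eq by (auto simp: last_map hd_map)
      then show "adj (edges G) (last (map x [0..<n])) (hd (map x [0..<n]))"
        using less.prems(2)[of "n - 1"] n by simp
    qed (use n in simp)
    with G(2) show False by blast
  qed
qed

text \<open>Words carry the newest branch first, so the longest common suffix \<open>c\<close> is
  the last common ancestor of two tree vertices.\<close>

lemma common_suffix:
  "\<exists>a b c. xs = a @ c \<and> ys = b @ c \<and> (a = [] \<or> b = [] \<or> last a \<noteq> last b)"
proof (induction xs arbitrary: ys rule: rev_induct)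
  case (snoc x xs)
  show ?case
  proof (cases ys rule: rev_cases)
    case (snoc ys' y)
    show ?thesis
    proof (cases "x = y")
      case True
      from snoc.IH[of ys'] obtain a b c where
        "xs = a @ c" "ys' = b @ c" "a = [] \<or> b = [] \<or> last a \<noteq> last b"
        by blast
      with True snoc show ?thesis
        by (intro exI[of _ a] exI[of _ b] exI[of _ "c @ [x]"]) simp
    next
      case False
      with snoc show ?thesis
        by (intro exI[of _ "xs @ [x]"] exI[of _ ys] exI[of _ "[]"]) simp
    qed
  qed auto
qed auto

lemma card_neighbours:
  assumes "simple_graph G"
  shows "card {u. {v, u} \<in> edges G} = vertex_degree G v"
proof -
  have "{e \<in> edges G. v \<in> e} = (\<lambda>u. {v, u}) ` {u. {v, u} \<in> edges G}"
  proof (intro equalityI subsetI)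
    fix e assume e: "e \<in> {e \<in> edges G. v \<in> e}"
    then have "card e = 2" using assms by (auto simp: simple_graph_def)
    then obtain y z where "e = {y, z}" by (auto simp: card_2_iff)
    with e show "e \<in> (\<lambda>u. {v, u}) ` {u. {v, u} \<in> edges G}"
      by (auto simp: insert_commute)
  qed auto
  moreover have "inj_on (\<lambda>u. {v, u}) A" for A
    by (auto simp: inj_on_def doubleton_eq_iff)
  ultimately show ?thesis
    by (simp add: vertex_degree_def card_image)
qed

text \<open>Climbing from \<open>w\<close> to the last common ancestor and descending to
  \<open>w'\<close> gives a walk that never backtracks, so in a tree its endpoints differ.\<close>

lemma tree_embedding_inj:
  assumes T: "tree_graph T"
    and edge: "\<And>w j. {node w, node (j # w)} \<in> edges T"
    and siblings: "\<And>w j j'. node (j # w) = node (j' # w) \<Longrightarrow> j = j'"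
    and no_return: "\<And>w j j'. node (j' # j # w) \<noteq> node w"
  shows "inj node"
proof (rule injI, rule ccontr)
  fix w w' assume eq: "node w = node w'" and neq: "w \<noteq> w'"
  obtain a b c where abc: "w = a @ c" "w' = b @ c" "a = [] \<or> b = [] \<or> last a \<noteq> last b"
    using common_suffix[of w w'] by blast
  define up down where "up i = drop i a @ c" and "down i = drop i b @ c" for i
  define n where "n = length a + length b"
  \<comment> \<open>The two formulas agree at the turning point \<open>i = length a\<close>, where
    both words equal \<open>c\<close>; hence \<open>x_up\<close> and \<open>x_down\<close> may both
    include it.\<close>
  define x where "x i = node (if i \<le> length a then up i else down (n - i))" for i
  have up: "up i = a ! i # up (Suc i)" if "i < length a" for i
    using that by (simp add: up_def Cons_nth_drop_Suc[symmetric])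
  have down: "down i = b ! i # down (Suc i)" if "i < length b" for i
    using that by (simp add: down_def Cons_nth_drop_Suc[symmetric])
  have x_up: "x i = node (up i)" if "i \<le> length a" for i
    using that by (simp add: x_def)
  have x_down: "x i = node (down (n - i))" if "length a \<le> i" for i
    using that by (auto simp: x_def up_def down_def n_def)
  have "x 0 \<noteq> x n"
  proof (rule nonbacktracking_walk_endpoints)
    show "0 < n" using neq abc by (auto simp: n_def)
  next
    fix i assume i: "i < n"
    show "adj (edges T) (x i) (x (Suc i))"
    proof (cases "i < length a")
      case True
      then show ?thesis
        using edge[of "up (Suc i)" "a ! i"]
        by (simp add: x_up up[of i] adj_def insert_commute)
    next
      case False
      then have "x i = node (down (Suc (n - Suc i)))" "x (Suc i) = node (down (n - Suc i))"
        using i by (simp_all add: x_down Suc_diff_Suc)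
      moreover have "n - Suc i < length b"
        using i False by (auto simp: n_def)
      ultimately show ?thesis
        using edge[of "down (Suc (n - Suc i))" "b ! (n - Suc i)"] by (simp add: down adj_def)
    qed
  next
    fix i assume i: "Suc (Suc i) \<le> n"
    \<comment> \<open>Two successive steps go up, go down, or turn at the ancestor;
      \<open>no_return\<close> settles the first two cases, \<open>siblings\<close> the
      turn.\<close>
    consider "Suc (Suc i) \<le> length a" | "length a \<le> i" | "Suc i = length a"
      by linarith
    then show "x i \<noteq> x (Suc (Suc i))"
    proof cases
      case 1
      then show ?thesis
        using no_return[of "a ! i" "a ! Suc i" "up (Suc (Suc i))"]
        by (simp add: x_up up[of i] up[of "Suc i"])
    next
      case 2
      define m where "m = n - (Suc (Suc i))"
      have m: "n - i = Suc (Suc m)" "m < length b" "Suc m < length b"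
        using i 2 by (auto simp: m_def n_def)
      then show ?thesis
        using no_return[of "b ! m" "b ! Suc m" "down (Suc (Suc m))"] 2
        by (simp add: x_down m_def[symmetric] m down[of m] down[of "Suc m"])
    next
      case 3
      then have ne: "a \<noteq> []" "b \<noteq> []" and i': "i = length a - 1" "n - (Suc (Suc i)) = length b - 1"
        using i by (auto simp: n_def)
      have "x i = node (last a # c)" "x (Suc (Suc i)) = node (last b # c)"
        using ne 3 up[of i] down[of "length b - 1"] i'
        by (simp_all add: x_up x_down last_conv_nth) (simp_all add: up_def down_def)
      then show ?thesis
        using siblings[of "last a" c "last b"] abc(3) ne by auto
    qed
  qed (use T in \<open>auto simp: tree_graph_def\<close>)
  moreover have "x 0 = node w" "x n = node w'"
    using x_up[of 0] x_down[of n] abc by (simp_all add: n_def up_def down_def)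
  ultimately show False
    using eq by simp
qed

lemma card_branch: "card (UNIV :: branch set) = 3"
proof -
  have UNIV_branch: "(UNIV :: branch set) = {Branch0, Branch1, Branch2}"
    using branch.exhaust by auto
  show ?thesis unfolding UNIV_branch by simp
qed

text \<open>Every vertex has four neighbours, so at least three remain after its parent is removed;
  three of them become its children.\<close>

lemma ternary_tree_embedding:
  assumes T: "infinite_regular_tree 4 T"
  obtains node :: "branch list \<Rightarrow> 'a" where
    "inj node" "\<And>w. node w \<in> verts T" "\<And>w j. {node w, node (j # w)} \<in> edges T"
proof -
  have simple: "simple_graph T" and tree: "tree_graph T"
    using T by (auto simp: infinite_regular_tree_def tree_graph_def)
  have "\<exists>g :: branch \<Rightarrow> 'a. inj g \<and> (\<forall>j. {v, g j} \<in> edges T \<and> g j \<noteq> u)" if "v \<in> verts T" for u v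
  proof -
    let ?N = "{u. {v, u} \<in> edges T}"
    have N: "card ?N = 4"
      using T that simple by (simp add: card_neighbours infinite_regular_tree_def)
    then have "finite ?N" by (metis card.infinite zero_neq_numeral)
    moreover have "card (UNIV :: branch set) \<le> card (?N - {u})"
      using N by (simp add: card_branch card_Diff_singleton_if)
    moreover have "finite (UNIV :: branch set)"
      using card_branch by (metis card.infinite zero_neq_numeral)
    ultimately obtain g :: "branch \<Rightarrow> 'a" where "range g \<subseteq> ?N - {u}" "inj g"
      using card_le_inj[of "UNIV :: branch set" "?N - {u}"] by auto
    then show ?thesis by blast
  qed
  then obtain ch :: "'a \<Rightarrow> 'a \<Rightarrow> branch \<Rightarrow> 'a" where
    ch: "\<And>v u. v \<in> verts T \<Longrightarrow> inj (ch v u)"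
      "\<And>v u j. v \<in> verts T \<Longrightarrow> {v, ch v u j} \<in> edges T"
      "\<And>v u j. v \<in> verts T \<Longrightarrow> ch v u j \<noteq> u"
    by metis
  obtain r where r: "r \<in> verts T"
    using T by (auto simp: infinite_regular_tree_def dest: infinite_imp_nonempty)
  \<comment> \<open>The recursion carries a vertex together with its parent. The root stands in for
    its own missing parent, which excludes no neighbour, as the graph has no loops.\<close>
  define np where "np = rec_list (r, r) (\<lambda>j (w :: branch list) (v, u). (ch v u j, v))"
  define node where "node w = fst (np w)" for w
  have node_Cons: "node (j # w) = ch (node w) (snd (np w)) j" "snd (np (j # w)) = node w" for j w
    by (simp_all add: node_def np_def split: prod.split)
  have verts: "node w \<in> verts T" for w
  proof (induction w)
    case Nil
    then show ?case using r by (simp add: node_def np_def)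
  next
    case (Cons j w)
    have "{node w, node (j # w)} \<in> edges T"
      unfolding node_Cons by (rule ch(2)[OF Cons.IH])
    then show ?case using simple by (auto simp: simple_graph_def)
  qed
  have edge: "{node w, node (j # w)} \<in> edges T" for w j
    unfolding node_Cons by (rule ch(2)[OF verts])
  moreover have "inj node"
  proof (rule tree_embedding_inj[OF tree edge])
    show "j = j'" if "node (j # w) = node (j' # w)" for w j j'
      using that ch(1)[OF verts] by (simp add: node_Cons inj_eq)
    show "node (j' # j # w) \<noteq> node w" for w j j'
      using ch(3)[OF verts] by (metis node_Cons)
  qed
  ultimately show ?thesis using verts that by blast
qed

section \<open>Downward survival in the model\<close>

text \<open>Vertices of the ternary tree are words, with the most recent branch first;
  \<open>Horizontal w k\<close> joins \<open>(w, k)\<close> to \<open>(w, k + 1)\<close> and \<open>Vertical w j k\<close> joins \<open>(w, k)\<close> to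
  \<open>(j # w, k)\<close>.\<close>

datatype model_edge = Horizontal "branch list" int | Vertical "branch list" branch int

primrec upper_word :: "model_edge \<Rightarrow> branch list" where
  "upper_word (Horizontal w k) = w"
| "upper_word (Vertical w j k) = w"

text \<open>With the newest branch first, the descendants of \<open>w\<close> are the words with
  suffix \<open>w\<close>. Filing a vertical edge under its upper end leaves the edges that enter
  the fibre of \<open>w\<close> from its parent out of \<open>below w\<close>, so they are
  independent of what happens there.\<close>

definition below :: "branch list \<Rightarrow> model_edge set" where
  "below w = {e. suffix w (upper_word e)}"

lemma below_mono: "suffix w v \<Longrightarrow> below v \<subseteq> below w"
  by (auto simp: below_def intro: suffix_order.order_trans)

lemma suffix_Cons_Cons_eq:
  assumes "suffix (j # w) x" "suffix (j' # w) x"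
  shows "j = j'"
  using assms by (auto simp: suffix_def)

lemma not_suffix_Cons_self: "\<not> suffix (j # w) w"
  by (auto dest: suffix_length_le)

text \<open>Paths that never climb make the event a function of \<open>below w\<close>. A horizontal
  edge is labelled by its left end, hence the half-open range between \<open>i\<close> and
  \<open>k\<close>.\<close>

primrec survive :: "nat \<Rightarrow> branch list \<Rightarrow> int \<Rightarrow> (model_edge \<Rightarrow> bool) \<Rightarrow> bool" where
  "survive 0 w i \<omega> \<longleftrightarrow> True"
| "survive (Suc n) w i \<omega> \<longleftrightarrow> (\<exists>k. (\<forall>m\<in>{min i k..<max i k}. \<omega> (Horizontal w m)) \<and>
    (\<exists>j. \<omega> (Vertical w j k) \<and> survive n (j # w) k \<omega>))"

lemma survive_antimono: "survive (Suc n) w i \<omega> \<Longrightarrow> survive n w i \<omega>"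
proof (induction n arbitrary: w i)
  case (Suc n)
  then show ?case
    by (subst survive.simps, subst (asm) survive.simps) blast
qed simp

lemma depends_on_survive: "depends_on (below w) (survive n w i)"
proof (rule depends_onI)
  fix \<omega> \<omega>' :: "model_edge \<Rightarrow> bool"
  assume "\<And>e. e \<in> below w \<Longrightarrow> \<omega> e = \<omega>' e"
  then show "survive n w i \<omega> = survive n w i \<omega>'"
  proof (induction n arbitrary: w i)
    case (Suc n)
    have "survive n (j # w) k \<omega> = survive n (j # w) k \<omega>'" for j k
      using below_mono[of w "j # w"] by (intro Suc.IH Suc.prems) (auto simp: suffix_Cons)
    moreover have "\<omega> (Horizontal w m) = \<omega>' (Horizontal w m)" "\<omega> (Vertical w j k) = \<omega>' (Vertical w j k)" for m j k
      by (auto simp: below_def intro!: Suc.prems)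
    ultimately show ?case by simp
  qed simp
qed

section \<open>From a fibre to its three child fibres\<close>

definition descend :: "nat \<Rightarrow> branch list \<Rightarrow> branch \<Rightarrow> int \<Rightarrow> (model_edge \<Rightarrow> bool) \<Rightarrow> bool" where
  "descend n w j k \<omega> \<longleftrightarrow> \<omega> (Vertical w j k) \<and> survive n (j # w) k \<omega>"

text \<open>All edges that decide the entry into child \<open>j\<close> and the survival there;
  these sets are disjoint for distinct \<open>j\<close>, which makes the children
  independent.\<close>

definition below_branch :: "branch list \<Rightarrow> branch \<Rightarrow> model_edge set" where
  "below_branch w j = range (Vertical w j) \<union> below (j # w)"

lemma depends_on_descend: "depends_on (below_branch w j) (\<lambda>\<omega>. \<exists>k\<in>S. descend n w j k \<omega>)"
proof (rule depends_onI)
  fix \<omega> \<omega>' :: "model_edge \<Rightarrow> bool"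
  assume *: "\<And>e. e \<in> below_branch w j \<Longrightarrow> \<omega> e = \<omega>' e"
  have "survive n (j # w) k \<omega> = survive n (j # w) k \<omega>'" for k
    by (rule depends_onD[OF depends_on_survive]) (simp add: * below_branch_def)
  then show "(\<exists>k\<in>S. descend n w j k \<omega>) = (\<exists>k\<in>S. descend n w j k \<omega>')"
    using * by (auto simp: descend_def below_branch_def)
qed

lemma below_branch_disjoint: "j \<noteq> j' \<Longrightarrow> below_branch w j \<inter> below_branch w j' = {}"
  using suffix_Cons_Cons_eq[of j w _ j'] not_suffix_Cons_self[of _ w]
  by (auto simp: below_branch_def below_def)

lemma Horizontal_notin_below_branch: "Horizontal w k \<notin> below_branch w j"
  using not_suffix_Cons_self[of j w] by (auto simp: below_branch_def below_def)

lemma Vertical_disjoint_below: "Vertical w j ` S \<inter> below (j # w) = {}"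
  using not_suffix_Cons_self[of j w] by (auto simp: below_def)

text \<open>Test function of the two-type branching process, the types being one hit site and at
  least two; it will bound the survival probability from below.\<close>

definition capped_value :: "real \<Rightarrow> real \<Rightarrow> nat \<Rightarrow> real" where
  "capped_value \<alpha> \<beta> k = (if k = 0 then 0 else if k = 1 then \<alpha> else \<beta>)"

lemma binomial_mean_capped_value:
  "k \<ge> 2 \<Longrightarrow> binomial_mean p (capped_value \<alpha> \<beta>) k m = \<beta>"
  by (induction m arbitrary: k) (auto simp: capped_value_def algebra_simps)

text \<open>The values \<open>(1, 1.56)\<close> approximate the Perron eigenvector of the mean matrix, whose
  eigenvalue exceeds 1 slightly; the scaling by \<open>1 / 1000\<close> makes the second-order loss in
  \<open>1 - (1 - x)\<^sup>3 \<ge> 3 x - 3 x\<^sup>2\<close> negligible.\<close>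

lemma capped_value_step:
  fixes f :: "nat \<Rightarrow> real" and p :: real
  defines "f \<equiv> capped_value (1 / 1000) (39 / 25000)" and "p \<equiv> 28 / 125"
  assumes "k \<in> {1, 2}"
  shows "f k \<le> geom_mean p 3 (\<lambda>l. geom_mean p 3 (\<lambda>r. 1 - (1 - binomial_mean p f 0 (k + l + r)) ^ 3))"
proof -
  have f: "f 0 = 0" "f (Suc 0) = 1 / 1000" "f (Suc (Suc 0)) = 39 / 25000"
    by (simp_all add: f_def capped_value_def)
  \<comment> \<open>From two hits on the cap is reached and averaging changes nothing, which
    collapses most terms of the double mean.\<close>
  have f2: "binomial_mean (28 / 125) f (Suc (Suc 0)) m = 39 / 25000" for m
    by (simp add: f_def binomial_mean_capped_value)
  from assms(3) consider "k = Suc 0" | "k = Suc (Suc 0)"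
    by auto
  then show ?thesis
    by cases (simp_all add: f f2 numeral_3_eq_3 p_def power_Suc)
qed

section \<open>Survival probabilities in the model\<close>

locale tree_line_model = bernoulli_product p \<mu> for p and \<mu> :: "(model_edge \<Rightarrow> bool) measure"
begin

lemma measurable_survive[measurable]: "Measurable.pred \<mu> (survive n w i)"
proof (induction n arbitrary: w i)
  case 0
  have "survive 0 w i = (\<lambda>_. True)"
    by (simp add: fun_eq_iff)
  then show ?case by simp
next
  case (Suc n)
  note [measurable] = Suc.IH
  have eq: "survive (Suc n) w i = (\<lambda>\<omega>. \<exists>k. (\<forall>m\<in>{min i k..<max i k}. \<omega> (Horizontal w m)) \<and>
      (\<exists>j. \<omega> (Vertical w j k) \<and> survive n (j # w) k \<omega>))"
    by (simp add: fun_eq_iff)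
  show ?case
    unfolding eq by measurable
qed

lemma measurable_descend[measurable]: "Measurable.pred \<mu> (descend n w j i)"
proof -
  have eq: "descend n w j i = (\<lambda>\<omega>. \<omega> (Vertical w j i) \<and> survive n (j # w) i \<omega>)"
    by (simp add: fun_eq_iff descend_def)
  show ?thesis
    unfolding eq by measurable
qed

text \<open>Each child fails with probability at most \<open>1 - x\<close>, where \<open>x\<close>
  comes from thinning \<open>S\<close> by the vertical edges; the three failures depend on disjoint
  edge sets, so their probabilities multiply.\<close>

lemma prob_children:
  assumes S: "finite S"
    and f: "\<And>j T. finite T \<Longrightarrow> f (card T) \<le> prob {\<omega>. \<exists>i\<in>T. survive n (j # w) i \<omega>}"
  shows "1 - (1 - binomial_mean p f 0 (card S)) ^ 3 \<le> prob {\<omega>. \<exists>k\<in>S. \<exists>j. descend n w j k \<omega>}"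
proof -
  define x where "x = binomial_mean p f 0 (card S)"
  let ?D = "\<lambda>j \<omega>. \<exists>k\<in>S. descend n w j k \<omega>"
  have D[measurable]: "Measurable.pred \<mu> (?D j)" for j
    by measurable
  have x: "x \<le> prob {\<omega>. ?D j \<omega>}" for j
    unfolding x_def descend_def
    using prob_thinned[of S "{}" "\<lambda>k. survive n (j # w) k" "below (j # w)" "Vertical w j" f]
      S f depends_on_survive Vertical_disjoint_below[of w j S]
    by (simp add: inj_on_def)
  define E where "E j = (\<lambda>\<omega>. \<not> ?D j \<omega>)" for j
  have E_meas: "Measurable.pred \<mu> (E j)" for j
    unfolding E_def by measurable
  have E_dep: "depends_on (below_branch w j) (E j)" for j
    unfolding E_def by (intro depends_on_Not depends_on_descend)
  have E_prob: "prob {\<omega>. E j \<omega>} \<le> 1 - x" for j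
    using x[of j] prob_not[OF D, of j] by (simp add: E_def)
  have "prob {\<omega>. \<not> (\<exists>k\<in>S. \<exists>j. descend n w j k \<omega>)} =
      prob {\<omega>. E Branch0 \<omega> \<and> E Branch1 \<omega> \<and> E Branch2 \<omega>}"
    by (rule arg_cong[of _ _ prob]) (auto simp: ex_branch E_def)
  also have "\<dots> = prob {\<omega>. E Branch0 \<omega>} * prob {\<omega>. E Branch1 \<omega> \<and> E Branch2 \<omega>}"
  proof (rule prob_conj)
    show "depends_on (below_branch w Branch1 \<union> below_branch w Branch2) (\<lambda>\<omega>. E Branch1 \<omega> \<and> E Branch2 \<omega>)"
      by (intro depends_on_conj depends_on_mono[OF E_dep]) auto
    show "below_branch w Branch0 \<inter> (below_branch w Branch1 \<union> below_branch w Branch2) = {}"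
      using below_branch_disjoint[of Branch0 Branch1 w] below_branch_disjoint[of Branch0 Branch2 w]
      by (simp add: Int_Un_distrib)
    show "Measurable.pred \<mu> (\<lambda>\<omega>. E Branch1 \<omega> \<and> E Branch2 \<omega>)"
      by (intro pred_intros_logic E_meas)
  qed (fact E_meas E_dep)+
  also have "prob {\<omega>. E Branch1 \<omega> \<and> E Branch2 \<omega>} = prob {\<omega>. E Branch1 \<omega>} * prob {\<omega>. E Branch2 \<omega>}"
    by (rule prob_conj[OF E_meas E_dep E_meas E_dep]) (simp add: below_branch_disjoint)
  \<comment> \<open>Multiplying the bounds requires \<open>1 - x\<close> to be nonnegative, which
    holds because \<open>x\<close> lies below a probability.\<close>
  also have "prob {\<omega>. E Branch0 \<omega>} * \<dots> \<le> (1 - x) * ((1 - x) * (1 - x))"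
    using E_prob order_trans[OF x prob_le_1] by (intro mult_mono) auto
  finally show ?thesis
    by (subst (asm) prob_not) (auto simp: x_def power3_eq_cube algebra_simps)
qed

text \<open>The hit set grows by the open runs leaving its two ends, each cut off at
  \<open>M\<close>; gaps inside \<open>B\<close> are left unexplored. The two runs and the descent
  use disjoint edges, so the means nest.\<close>

lemma prob_survive_step:
  assumes B: "finite B" "B \<noteq> {}"
    and f: "\<And>j T. finite T \<Longrightarrow> f (card T) \<le> prob {\<omega>. \<exists>i\<in>T. survive n (j # w) i \<omega>}"
  shows "geom_mean p M (\<lambda>l. geom_mean p M (\<lambda>r. 1 - (1 - binomial_mean p f 0 (card B + l + r)) ^ 3))
    \<le> prob {\<omega>. \<exists>i\<in>B. survive (Suc n) w i \<omega>}"
proof -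
  define a b where "a = Min B" and "b = Max B"
  have ab: "a \<in> B" "b \<in> B" "\<And>i. i \<in> B \<Longrightarrow> a \<le> i \<and> i \<le> b"
    using B by (auto simp: a_def b_def)
  \<comment> \<open>Sites are added only outside the interval from \<open>a\<close> to
    \<open>b\<close>, so their number is exactly \<open>l + r\<close>.\<close>
  define S where "S l r = B \<union> {a - int l..<a} \<union> {b<..b + int r}" for l r
  have card_S: "card (S l r) = card B + l + r" for l r
  proof -
    have "(B \<union> {a - int l..<a}) \<inter> {b<..b + int r} = {}" "B \<inter> {a - int l..<a} = {}"
      using ab by force+
    then show ?thesis
      using B by (simp add: S_def card_Un_disjoint)
  qed
  have fin_S: "finite (S l r)" for l r
    using B by (simp add: S_def)
  let ?Q = "\<lambda>l r \<omega>. \<exists>k\<in>S l r. \<exists>j. descend n w j k \<omega>"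
  \<comment> \<open>As edges are labelled by their left end, the right run starts with label
    \<open>b\<close> and the left run with label \<open>a - 1\<close>; since
    \<open>a \<le> b\<close>, they share no edge.\<close>
  let ?R = "\<lambda>l \<omega>. \<exists>r\<le>M. (\<forall>s<r. \<omega> (Horizontal w (b + int s))) \<and> ?Q l r \<omega>"
  let ?L = "\<lambda>\<omega>. \<exists>l\<le>M. (\<forall>s<l. \<omega> (Horizontal w (a - 1 - int s))) \<and> ?R l \<omega>"
  let ?J = "\<Union>j. below_branch w j"
  \<comment> \<open>The event \<open>?R l\<close> already involves the right run, so its edges join
    the set that the left run has to avoid.\<close>
  let ?K = "?J \<union> (\<lambda>s. Horizontal w (b + int s)) ` {..<M}"
  have depQ: "depends_on ?J (?Q l r)" for l r
  proof -
    have "depends_on ?J (\<lambda>\<omega>. \<exists>k\<in>S l r. descend n w j k \<omega>)" for j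
      by (rule depends_on_mono[OF depends_on_descend]) auto
    then have "depends_on ?J (\<lambda>\<omega>. \<exists>j. \<exists>k\<in>S l r. descend n w j k \<omega>)"
      unfolding ex_branch by (intro depends_on_disj)
    moreover have "(\<lambda>\<omega>. \<exists>j. \<exists>k\<in>S l r. descend n w j k \<omega>) = ?Q l r"
      by (auto simp: fun_eq_iff)
    ultimately show ?thesis by (simp only:)
  qed
  have measR: "Measurable.pred \<mu> (?R l)" for l
    by (rule pred_run) measurable
  have depR: "depends_on ?K (?R l)" for l
  proof (rule depends_onI)
    fix \<omega> \<omega>' :: "model_edge \<Rightarrow> bool"
    assume eq: "\<omega> e = \<omega>' e" if "e \<in> ?K" for e
    have Q: "?Q l r \<omega> = ?Q l r \<omega>'" for r
      by (rule depends_onD[OF depQ]) (simp add: eq)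
    have "\<omega> (Horizontal w (b + int s)) = \<omega>' (Horizontal w (b + int s))" if "s < M" for s
      using that by (intro eq) auto
    with Q show "?R l \<omega> = ?R l \<omega>'"
      by (meson less_le_trans)
  qed
  have "geom_mean p M (\<lambda>l. geom_mean p M (\<lambda>r. 1 - (1 - binomial_mean p f 0 (card B + l + r)) ^ 3))
      \<le> geom_mean p M (\<lambda>l. geom_mean p M (\<lambda>r. prob {\<omega>. ?Q l r \<omega>}))"
    using prob_children[OF fin_S f] p01
    by (intro geom_mean_mono) (auto simp: card_S)
  also have "\<dots> \<le> geom_mean p M (\<lambda>l. prob {\<omega>. ?R l \<omega>})"
    using p01 depQ Horizontal_notin_below_branch
    by (intro geom_mean_mono prob_run[where J = ?J]) (auto simp: inj_on_def)
  also have "\<dots> \<le> prob {\<omega>. ?L \<omega>}"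
    using measR depR Horizontal_notin_below_branch ab(3)[OF ab(2)]
    by (intro prob_run[where J = ?K]) (auto simp: inj_on_def)
  also have "\<dots> \<le> prob {\<omega>. \<exists>i\<in>B. survive (Suc n) w i \<omega>}"
  proof (rule prob_mono)
    fix \<omega> assume "?L \<omega>"
    then obtain l r k j where left: "\<And>s. s < l \<Longrightarrow> \<omega> (Horizontal w (a - 1 - int s))"
      and right: "\<And>s. s < r \<Longrightarrow> \<omega> (Horizontal w (b + int s))"
      and k: "k \<in> S l r" and d: "descend n w j k \<omega>"
      by blast
    from k consider "k \<in> B" | "k \<in> {a - int l..<a}" | "k \<in> {b<..b + int r}"
      by (auto simp: S_def)
    \<comment> \<open>A new site is linked along its run to the end of \<open>B\<close> on its side;
      a site of \<open>B\<close> is its own starting point.\<close>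
    then have "\<exists>i\<in>B. \<forall>m\<in>{min i k..<max i k}. \<omega> (Horizontal w m)"
    proof cases
      case 1
      then show ?thesis by (intro bexI[of _ k]) auto
    next
      case 2
      have "\<omega> (Horizontal w m)" if "m \<in> {k..<a}" for m
        using left[of "nat (a - 1 - m)"] that 2 by auto
      with 2 ab show ?thesis by (intro bexI[of _ a]) (auto simp: min_def max_def)
    next
      case 3
      have "\<omega> (Horizontal w m)" if "m \<in> {b..<k}" for m
        using right[of "nat (m - b)"] that 3 by auto
      with 3 ab show ?thesis by (intro bexI[of _ b]) (auto simp: min_def max_def)
    qed
    with d show "\<exists>i\<in>B. survive (Suc n) w i \<omega>"
      by (auto simp: descend_def)
  qed measurable
  finally show ?thesis .
qed

text \<open>Induction on the depth \<open>n\<close>: the hypothesis \<open>step\<close> makes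
  \<open>capped_value\<close> a subsolution of the recursion in
  \<open>prob_survive_step\<close>.\<close>

lemma prob_survive:
  assumes le1: "\<alpha> \<le> 1" "\<beta> \<le> 1"
    and step: "\<And>k. k \<in> {1, 2} \<Longrightarrow> capped_value \<alpha> \<beta> k \<le> geom_mean p M (\<lambda>l. geom_mean p M
      (\<lambda>r. 1 - (1 - binomial_mean p (capped_value \<alpha> \<beta>) 0 (k + l + r)) ^ 3))"
  shows "finite B \<Longrightarrow> capped_value \<alpha> \<beta> (card B) \<le> prob {\<omega>. \<exists>i\<in>B. survive n w i \<omega>}"
proof (induction n arbitrary: w B)
  case 0
  \<comment> \<open>At depth 0 survival is certain for nonempty \<open>B\<close>, so the bounds by 1
    on \<alpha> and \<beta> suffice.\<close>
  have "{\<omega>. \<exists>i\<in>B. survive 0 w i \<omega>} = (if B = {} then {} else space \<mu>)"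
    by auto
  then show ?case
    using le1 0 prob_space by (auto simp: capped_value_def)
next
  case (Suc n)
  show ?case
  proof (cases "B = {}")
    case False
    \<comment> \<open>Keeping at most two hit sites reduces any nonempty \<open>B\<close> to one of
      the two types without changing \<open>capped_value\<close>; discarding sites only lowers the
      probability.\<close>
    define k where "k = min (card B) 2"
    have "card B \<noteq> 0"
      using False Suc.prems by simp
    then have k: "k \<in> {1, 2}" "capped_value \<alpha> \<beta> (card B) = capped_value \<alpha> \<beta> k"
      by (auto simp: k_def capped_value_def min_def)
    have "k \<le> card B" by (simp add: k_def)
    then obtain C where C: "C \<subseteq> B" "card C = k"
      by (rule obtain_subset_with_card_n)
    then have finC: "finite C" "C \<noteq> {}"
      using k Suc.prems by (auto dest: finite_subset)
    have "capped_value \<alpha> \<beta> k \<le> prob {\<omega>. \<exists>i\<in>C. survive (Suc n) w i \<omega>}"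
      using step[OF k(1)] prob_survive_step[OF finC Suc.IH, of M w] C by simp
    also have "\<dots> \<le> prob {\<omega>. \<exists>i\<in>B. survive (Suc n) w i \<omega>}"
      using C by (intro prob_mono) (auto simp del: survive.simps)
    finally show ?thesis using k by simp
  qed (simp add: capped_value_def)
qed

lemma prob_survive_forever:
  assumes "\<And>n. \<alpha> \<le> prob {\<omega>. survive n w i \<omega>}"
  shows "\<alpha> \<le> prob {\<omega>. \<forall>n. survive n w i \<omega>}"
proof -
  have "decseq (\<lambda>n. {\<omega>. survive n w i \<omega>})"
    using survive_antimono by (intro decseq_SucI) blast
  then have "(\<lambda>n. prob {\<omega>. survive n w i \<omega>}) \<longlonglongrightarrow> prob (\<Inter>n. {\<omega>. survive n w i \<omega>})"
    by (intro finite_Lim_measure_decseq) auto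
  moreover have "(\<Inter>n. {\<omega>. survive n w i \<omega>}) = {\<omega>. \<forall>n. survive n w i \<omega>}"
    by auto
  ultimately show ?thesis
    using assms by (auto intro: LIMSEQ_le_const)
qed

text \<open>The subtrees hanging off a ray supply infinitely many independent attempts.\<close>

lemma AE_survive_forever:
  assumes \<alpha>: "0 < \<alpha>" "\<And>w. \<alpha> \<le> prob {\<omega>. \<forall>n. survive n w i \<omega>}"
  shows "AE \<omega> in \<mu>. \<exists>w. \<forall>n. survive n w i \<omega>"
proof -
  \<comment> \<open>The ray consists of copies of \<open>Branch1\<close>; \<open>v m\<close> leaves
    it after \<open>m\<close> steps through \<open>Branch0\<close>.\<close>
  define v where "v m = Branch0 # replicate m Branch1" for m
  define F where "F m = (\<lambda>\<omega>. \<not> (\<forall>n. survive n (v m) i \<omega>))" for m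
  have F_meas[measurable]: "Measurable.pred \<mu> (F m)" for m
    unfolding F_def by measurable
  have F_dep: "depends_on (below (v m)) (F m)" for m
  proof (rule depends_onI)
    fix \<omega> \<omega>' :: "model_edge \<Rightarrow> bool"
    assume "\<And>e. e \<in> below (v m) \<Longrightarrow> \<omega> e = \<omega>' e"
    then have "survive n (v m) i \<omega> = survive n (v m) i \<omega>'" for n
      by (rule depends_onD[OF depends_on_survive])
    then show "F m \<omega> = F m \<omega>'" by (simp add: F_def)
  qed
  have disj: "below (v m) \<inter> below (v m') = {}" if "m < m'" for m m'
  proof -
    have "\<not> suffix (v m) (v m')"
    proof
      assume "suffix (v m) (v m')"
      then obtain u where u: "v m' = u @ v m" by (auto simp: suffix_def)
      then have "length u = m' - m" using that by (auto simp: v_def dest!: arg_cong[of _ _ length])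
      \<comment> \<open>The head of \<open>v m\<close> would put \<open>Branch0\<close> at the
        positive position \<open>m' - m\<close> of \<open>v m'\<close>, where only
        \<open>Branch1\<close> stands.\<close>
      with u that have "v m' ! (m' - m) = Branch0" by (simp add: nth_append v_def)
      then show False using that by (simp add: v_def nth_Cons')
    qed
    then have "\<not> (suffix (v m) x \<and> suffix (v m') x)" for x
      using that suffix_length_suffix[of "v m" x "v m'"] by (auto simp: v_def)
    then show ?thesis by (auto simp: below_def)
  qed
  have bound: "prob {\<omega>. \<forall>m<N. F m \<omega>} \<le> (1 - \<alpha>) ^ N" for N
  proof (induction N)
    case 0
    then show ?case using prob_space by simp
  next
    case (Suc N)
    have "prob {\<omega>. \<forall>m<Suc N. F m \<omega>} = prob {\<omega>. F N \<omega> \<and> (\<forall>m<N. F m \<omega>)}"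
      by (rule arg_cong[of _ _ prob]) (auto simp: less_Suc_eq)
    also have "\<dots> = prob {\<omega>. F N \<omega>} * prob {\<omega>. \<forall>m<N. F m \<omega>}"
    proof (rule prob_conj[OF F_meas F_dep])
      show "depends_on (\<Union>m<N. below (v m)) (\<lambda>\<omega>. \<forall>m<N. F m \<omega>)"
      proof (rule depends_onI)
        fix \<omega> \<omega>' :: "model_edge \<Rightarrow> bool"
        assume eq: "\<And>e. e \<in> (\<Union>m<N. below (v m)) \<Longrightarrow> \<omega> e = \<omega>' e"
        have "F m \<omega> = F m \<omega>'" if "m < N" for m
          using that by (intro depends_onD[OF F_dep] eq) auto
        then show "(\<forall>m<N. F m \<omega>) = (\<forall>m<N. F m \<omega>')" by simp
      qed
      show "below (v N) \<inter> (\<Union>m<N. below (v m)) = {}"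
        using disj by blast
    qed measurable
    also have "\<dots> \<le> (1 - \<alpha>) * (1 - \<alpha>) ^ N"
    proof (rule mult_mono)
      have "prob {\<omega>. F N \<omega>} = 1 - prob {\<omega>. \<forall>n. survive n (v N) i \<omega>}"
        unfolding F_def by (rule prob_not) measurable
      with \<alpha>(2)[of "v N"] show "prob {\<omega>. F N \<omega>} \<le> 1 - \<alpha>" by simp
    qed (use Suc.IH order_trans[OF \<alpha>(2) prob_le_1] in auto)
    finally show ?case by simp
  qed
  let ?bad = "{\<omega>. \<not> (\<exists>w. \<forall>n. survive n w i \<omega>)}"
  have bad: "?bad \<in> events" by simp
  have "prob ?bad \<le> (1 - \<alpha>) ^ N" for N
  proof -
    \<comment> \<open>If no word survives forever, then in particular the first \<open>N\<close>
      exits from the ray fail.\<close>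
    have "prob ?bad \<le> prob {\<omega>. \<forall>m<N. F m \<omega>}"
      by (rule prob_mono) (auto simp: F_def)
    with bound[of N] show ?thesis by simp
  qed
  moreover have "(\<lambda>N. (1 - \<alpha>) ^ N) \<longlonglongrightarrow> 0"
    using \<alpha>(1) order_trans[OF \<alpha>(2) prob_le_1] by (intro LIMSEQ_realpow_zero) auto
  ultimately have "prob ?bad \<le> 0"
    by (auto intro: LIMSEQ_le_const)
  then have "prob ?bad = 0"
    by (simp add: measure_le_0_iff)
  then show ?thesis
    using prob_eq_0[OF bad] by simp
qed

end

section \<open>Transfer to the product graph\<close>

primrec embed_edge :: "(branch list \<Rightarrow> 'a) \<Rightarrow> model_edge \<Rightarrow> ('a \<times> int) set" where
  "embed_edge node (Horizontal w k) = {(node w, k), (node w, k + 1)}"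
| "embed_edge node (Vertical w j k) = {(node w, k), (node (j # w), k)}"

lemma embed_edge_inj:
  assumes "inj node"
  shows "inj (embed_edge node)"
proof (rule injI)
  fix e e' assume "embed_edge node e = embed_edge node e'"
  then show "e = e'"
    by (cases e; cases e') (auto simp: doubleton_eq_iff inj_eq[OF assms])
qed

lemma embed_edge_edges:
  assumes "\<And>w. node w \<in> verts T" "\<And>w j. {node w, node (j # w)} \<in> edges T"
  shows "embed_edge node e \<in> edges (cartesian_product T int_line)"
proof (cases e)
  case (Horizontal w k)
  with assms show ?thesis
    by (auto simp: cartesian_product_def int_line_def)
      (rule exI[of _ "node w"], rule exI[of _ k], rule exI[of _ "node w"], rule exI[of _ "k + 1"], auto)
next
  case (Vertical w j k)
  with assms show ?thesis
    by (auto simp: cartesian_product_def int_line_def)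
      (rule exI[of _ "node w"], rule exI[of _ k], rule exI[of _ "node (j # w)"], rule exI[of _ k], auto)
qed

lemma adj_commute: "adj E u v \<longleftrightarrow> adj E v u"
  by (simp add: adj_def insert_commute)

text \<open>Survival to every depth puts vertices of every greater depth into the cluster, and
  \<open>inv node\<close> recovers the depth, which is therefore unbounded on it.\<close>

lemma infinite_cluster_of_survive:
  assumes inj: "inj node" and emb: "\<And>e. embed_edge node e \<in> edges G"
    and survive: "\<And>n. survive n w i (\<lambda>e. \<omega> (embed_edge node e))"
  shows "infinite (cluster G \<omega> (node w, i))"
proof
  let ?conn = "(adj (open_edges G \<omega>))\<^sup>*\<^sup>*"
  have sym: "?conn x y \<Longrightarrow> ?conn y x" for x y
    using symp_rtranclp[of "adj (open_edges G \<omega>)"] adj_commute by (metis sympD sympI)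
  have step: "adj (open_edges G \<omega>) x y" if "{x, y} = embed_edge node e" "\<omega> (embed_edge node e)" for x y e
    using that emb[of e] by (simp add: adj_def open_edges_def)
  have right: "?conn (node v, k) (node v, k + int t)"
    if "\<And>m. k \<le> m \<Longrightarrow> m < k + int t \<Longrightarrow> \<omega> (embed_edge node (Horizontal v m))" for v k t
    using that
  proof (induction t)
    case (Suc t)
    have "adj (open_edges G \<omega>) (node v, k + int t) (node v, k + int (Suc t))"
      using Suc.prems[of "k + int t"]
      by (intro step[of _ _ "Horizontal v (k + int t)"]) (simp_all add: ac_simps)
    moreover have "?conn (node v, k) (node v, k + int t)"
      using Suc.prems by (intro Suc.IH) auto
    ultimately show ?case by (rule rtranclp.rtrancl_into_rtrancl[rotated])
  qed simp
  have horizontal: "?conn (node v, k) (node v, l)"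
    if "\<forall>m\<in>{min k l..<max k l}. \<omega> (embed_edge node (Horizontal v m))" for v k l
  proof (cases "k \<le> l")
    case True
    then show ?thesis using right[of k "nat (l - k)" v] that by (simp add: min_def max_def)
  next
    case False
    then have "?conn (node v, l) (node v, k)"
      using right[of l "nat (k - l)" v] that by (simp add: min_def max_def)
    then show ?thesis by (rule sym)
  qed
  have reach: "\<exists>u k. length u = n \<and> ?conn (node v, i) (node (u @ v), k)"
    if "survive n v i (\<lambda>e. \<omega> (embed_edge node e))" for n v i
    using that
  proof (induction n arbitrary: v i)
    case 0
    then show ?case by (intro exI[of _ "[]"]) auto
  next
    case (Suc n)
    then obtain k j where kj: "\<forall>m\<in>{min i k..<max i k}. \<omega> (embed_edge node (Horizontal v m))"
      "\<omega> (embed_edge node (Vertical v j k))" "survive n (j # v) k (\<lambda>e. \<omega> (embed_edge node e))"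
      by auto
    from Suc.IH[OF kj(3)] obtain u l where ul: "length u = n" "?conn (node (j # v), k) (node (u @ j # v), l)"
      by blast
    have "?conn (node v, i) (node v, k)" by (rule horizontal[OF kj(1)])
    also have "adj (open_edges G \<omega>) (node v, k) (node (j # v), k)"
      by (rule step[OF _ kj(2)]) simp
    also note ul(2)
    \<comment> \<open>The child entered first is the oldest branch of the path, so it stands at the
      end of the new word.\<close>
    finally show ?case using ul(1) by (intro exI[of _ "u @ [j]"] exI[of _ l]) simp
  qed
  assume "finite (cluster G \<omega> (node w, i))"
  then have "finite ((\<lambda>x. length (inv node (fst x))) ` cluster G \<omega> (node w, i))"
    by (rule finite_imageI)
  moreover have "n + length w \<in> (\<lambda>x. length (inv node (fst x))) ` cluster G \<omega> (node w, i)" for n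
  proof -
    obtain u k where u: "length u = n" "?conn (node w, i) (node (u @ w), k)"
      using reach[OF survive] by blast
    then have "(node (u @ w), k) \<in> cluster G \<omega> (node w, i)"
      by (simp add: cluster_def component_def)
    moreover have "n + length w = length (inv node (fst (node (u @ w), k)))"
      using u by (simp add: inv_f_f[OF inj])
    ultimately show ?thesis by (rule rev_image_eqI)
  qed
  ultimately have "finite (range (\<lambda>n. n + length w))"
    by (auto elim: finite_subset[rotated])
  then show False
    by (simp add: finite_image_iff inj_on_def)
qed

text \<open>The embedding picks out distinct edges, so their states have the product law of the
  model; almost sure survival there is pulled back to the full graph.\<close>

lemma AE_infinite_cluster:
  fixes T :: "'a graph"
  assumes T: "infinite_regular_tree 4 T"
  defines "G \<equiv> cartesian_product T int_line"
  shows "AE \<omega> in bond_percolation G (28 / 125). \<exists>x\<in>verts G. infinite (cluster G \<omega> x)"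
proof -
  obtain node :: "branch list \<Rightarrow> 'a" where node: "inj node" "\<And>w. node w \<in> verts T" "\<And>w j. {node w, node (j # w)} \<in> edges T"
    using ternary_tree_embedding[OF T] by blast
  let ?B = "measure_pmf (bernoulli_pmf (28 / 125))"
  let ?\<mu> = "Pi\<^sub>M (UNIV :: model_edge set) (\<lambda>_. ?B)"
  let ?pull = "\<lambda>\<omega> e. \<omega> (embed_edge node e)"
  have emb: "embed_edge node e \<in> edges G" for e
    unfolding G_def by (rule embed_edge_edges[OF node(2,3)])
  interpret tree_line_model "28 / 125" ?\<mu>
    by unfold_locales auto
  \<comment> \<open>A single starting site has the first type, whose value is
    \<open>1 / 1000\<close>.\<close>
  have "1 / 1000 \<le> prob {\<omega>. survive n w 0 \<omega>}" for n w
    using prob_survive[of "1 / 1000" "39 / 25000" 3 "{0}" n w, OF _ _ capped_value_step]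
    by (simp add: capped_value_def)
  then have "AE \<omega> in ?\<mu>. \<exists>w. \<forall>n. survive n w 0 \<omega>"
    by (intro AE_survive_forever[of "1 / 1000"] prob_survive_forever) simp
  moreover have "distr (bond_percolation G (28 / 125)) ?\<mu> ?pull = ?\<mu>"
    using distr_PiM_reindex[of "edges G" "\<lambda>_. ?B" "embed_edge node" UNIV] emb embed_edge_inj[OF node(1)]
    by (simp add: bond_percolation_def prob_space_measure_pmf restrict_UNIV)
  ultimately have "AE \<omega> in distr (bond_percolation G (28 / 125)) ?\<mu> ?pull. \<exists>w. \<forall>n. survive n w 0 \<omega>"
    by (simp only:)
  moreover have "?pull \<in> measurable (bond_percolation G (28 / 125)) ?\<mu>"
    unfolding bond_percolation_def
    by (intro measurable_PiM_single' measurable_component_singleton) (simp_all add: emb)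
  ultimately have "AE \<omega> in bond_percolation G (28 / 125). \<exists>w. \<forall>n. survive n w 0 (?pull \<omega>)"
    by (rule AE_distrD[rotated])
  then show ?thesis
  proof eventually_elim
    case (elim \<omega>)
    then obtain w where "\<forall>n. survive n w 0 (?pull \<omega>)" by blast
    then have "infinite (cluster G \<omega> (node w, 0))"
      by (intro infinite_cluster_of_survive[OF node(1) emb]) auto
    moreover have "(node w, 0) \<in> verts G"
      using node(2) by (simp add: G_def cartesian_product_def int_line_def)
    ultimately show ?case by blast
  qed
qed

theorem theorem2:
  fixes T :: "'a graph"
  assumes "infinite_regular_tree 4 T"
  shows "critical_prob (cartesian_product T int_line) < 0.225"
proof -
  \<comment> \<open>The parameter \<open>28 / 125\<close> is 0.224 and belongs to the set whose
    infimum is taken; 0 bounds that set below.\<close>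
  have "critical_prob (cartesian_product T int_line) \<le> 28 / 125"
    unfolding critical_prob_def
    using AE_infinite_cluster[OF assms] by (intro cInf_lower bdd_belowI[of _ 0]) auto
  then show ?thesis by simp
qed

end
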